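(* Let $t\ge 2$. For every class $\mathcal{H}$ of graphs excluding $K_t$ as a minor, the class of region intersection graphs over $\mathcal{H}$ has asymptotic dimension at most $2^{t-2}-1$.
   Context: Graphs are finite, simple and undirected; $\mathbb{N}=\{1,2,\ldots\}$, $[k]=\{1,\ldots,k\}$. A region intersection model of a graph $G$ over a graph $H$ is a mapping $\mu$ from $V(G)$ to connected vertex sets in $H$ such that, for distinct $u,v\in V(G)$, $\mu(u)\cap\mu(v)\ne\emptyset$ exactly when $uv$ is an edge of $G$. $G$ is a region intersection graph over $\mathcal{H}$ if it has a region intersection model over some $H\in\mathcal{H}$. $d_G(x,y)$ is the shortest-path distance in $G$ ($\infty$ between different components). The diameter of $S\subseteq V(G)$ in $G$ is $\max_{x,y\in S}d_G(x,y)$. A family $\mathcal{U}$ of subsets of $V(G)$ is $\delta$-disjoint if all distinct $X,Y\in\mathcal{U}$ satisfy $\min_{x\in X}\min_{y\in Y}d_G(x,y)>\delta$, and $(k,\delta)$-disjoint if $\mathcal{U}=\bigcup_{i=1}^k\mathcal{U}_i$ where each $\mathcal{U}_i$, $i\in[k]$, is $\delta$-disjoint. A function $f\colon\{0,1,2,\ldots\}\to\mathbb{N}$ is a $d$-dimensional control function for $G$ if for every integer $\delta\ge0$ there is a $(d+1,\delta)$-disjoint partition of $V(G)$ into sets of diameter at most $f(\delta)$ in $G$. The asymptotic dimension of a graph class $\mathcal{G}$ is the minimum $d$ such that there is a $d$-dimensional control function common for all graphs in $\mathcal{G}$ (infinite if no such $d$ exists). *)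

theory Defs
  imports
    "Graph_Theory.Graph_Theory"
    "HOL-Library.Extended_Nat"
    "HOL-Library.Disjoint_Sets"
begin

(* Finite simple undirected graphs are the structures satisfying pair_graph: finite, loopless,
   symmetric digraphs without parallel arcs; an edge uv is the pair of arcs (u,v), (v,u). *)

definition connected_vertex_set :: "'a pair_pre_digraph \<Rightarrow> 'a set \<Rightarrow> bool" where
  "connected_vertex_set H S \<longleftrightarrow> S \<subseteq> pverts H \<and> connected (with_proj H \<restriction> S)"

(* The null graph is not connected in Graph_Theory, so connected vertex sets are nonempty. *)
lemma connected_vertex_set_nonempty:
  "connected_vertex_set H S \<Longrightarrow> S \<noteq> {}"
  by (auto simp: connected_vertex_set_def connected_def strongly_connected_def
      mk_symmetric_def induce_subgraph_def)

definition complete_graph :: "nat \<Rightarrow> nat pair_pre_digraph" where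
  "complete_graph t = \<lparr> pverts = {..<t}, parcs = {(i, j). i < t \<and> j < t \<and> i \<noteq> j} \<rparr>"

lemma complete_digraph_complete_graph: "K\<^bsub>t\<^esub> (with_proj (complete_graph t))"
  by (auto simp: complete_digraph_pair_def complete_graph_def)

(* B assigns to each vertex of F its branch set in H. *)
definition is_minor :: "'b pair_pre_digraph \<Rightarrow> 'a pair_pre_digraph \<Rightarrow> bool" where
  "is_minor F H \<longleftrightarrow> (\<exists>B :: 'b \<Rightarrow> 'a set.
     (\<forall>u \<in> pverts F. connected_vertex_set H (B u)) \<and>
     (\<forall>u \<in> pverts F. \<forall>v \<in> pverts F. u \<noteq> v \<longrightarrow> B u \<inter> B v = {}) \<and>
     (\<forall>(u, v) \<in> parcs F. \<exists>x \<in> B u. \<exists>y \<in> B v. (x, y) \<in> parcs H))"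

definition region_intersection_model ::
    "'b pair_pre_digraph \<Rightarrow> 'a pair_pre_digraph \<Rightarrow> ('b \<Rightarrow> 'a set) \<Rightarrow> bool" where
  "region_intersection_model G H m \<longleftrightarrow>
     (\<forall>v \<in> pverts G. connected_vertex_set H (m v)) \<and>
     (\<forall>u \<in> pverts G. \<forall>v \<in> pverts G. u \<noteq> v \<longrightarrow>
        (m u \<inter> m v \<noteq> {} \<longleftrightarrow> (u, v) \<in> parcs G))"

definition region_intersection_graphs ::
    "'a pair_pre_digraph set \<Rightarrow> 'b pair_pre_digraph set" where
  "region_intersection_graphs \<H> =
     {G. pair_graph G \<and> (\<exists>H \<in> \<H>. \<exists>m. region_intersection_model G H m)}"

definition graph_dist :: "'a pair_pre_digraph \<Rightarrow> 'a \<Rightarrow> 'a \<Rightarrow> enat" where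
  "graph_dist G x y = (INF p \<in> {p. pre_digraph.apath (with_proj G) x p y}. enat (length p))"

(* Used for nonempty S only; the diameter is measured in G, not in the subgraph induced by S. *)
definition diam_in :: "'a pair_pre_digraph \<Rightarrow> 'a set \<Rightarrow> enat" where
  "diam_in G S = (SUP x \<in> S. SUP y \<in> S. graph_dist G x y)"

definition disjoint_family_at ::
    "'a pair_pre_digraph \<Rightarrow> nat \<Rightarrow> 'a set set \<Rightarrow> bool" where
  "disjoint_family_at G \<delta> U \<longleftrightarrow>
     (\<forall>X \<in> U. \<forall>Y \<in> U. X \<noteq> Y \<longrightarrow> (INF x \<in> X. INF y \<in> Y. graph_dist G x y) > enat \<delta>)"

definition k_disjoint_family_at ::
    "'a pair_pre_digraph \<Rightarrow> nat \<Rightarrow> nat \<Rightarrow> 'a set set \<Rightarrow> bool" where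
  "k_disjoint_family_at G k \<delta> U \<longleftrightarrow>
     (\<exists>W :: nat \<Rightarrow> 'a set set. U = (\<Union>i \<in> {1..k}. W i) \<and>
        (\<forall>i \<in> {1..k}. disjoint_family_at G \<delta> (W i)))"

definition control_function ::
    "nat \<Rightarrow> (nat \<Rightarrow> nat) \<Rightarrow> 'a pair_pre_digraph \<Rightarrow> bool" where
  "control_function d f G \<longleftrightarrow>
     (\<forall>\<delta>. f \<delta> \<ge> 1) \<and>
     (\<forall>\<delta>. \<exists>U. partition_on (pverts G) U \<and> k_disjoint_family_at G (d + 1) \<delta> U \<and>
        (\<forall>S \<in> U. diam_in G S \<le> enat (f \<delta>)))"

(* The infimum of the empty set is infinity in enat. *)
definition asymptotic_dimension :: "'a pair_pre_digraph set \<Rightarrow> enat" where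
  "asymptotic_dimension \<G> =
     (INF d \<in> {d. \<exists>f. \<forall>G \<in> \<G>. control_function d f G}. enat d)"

end

(* The argument is that of Klein, Plotkin and Rao, carried out in H rather than in G. Fix delta and
   cover H by the regions rho(v), the unions of the model sets over the delta-balls of G; H then
   carries the metric counting the regions needed to get from one vertex to another, and every
   subset S of V(H) carries the analogous metric whose steps stay inside S. Colour a connected S by
   the parity of the distance from a root together with, recursively, a colouring of the components
   of three consecutive distance layers. After t - 2 rounds this uses 2^(t-2) colours, and a
   monochromatic component lies in the last member K of a nested sequence of t - 2 such components.
   If K had large diameter in S, take t far apart vertices p_0, ..., p_(t-1) of K. Each round
   contributes one connected set (a ball around the root, cut off well above K) which all the p_j
   reach along short disjoint descending walks. The t - 2 balls, each merged with the walks of its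
   own vertex among p_2, ..., p_(t-1), together with p_0 and p_1, which are joined inside K, form a
   K_t minor of H. *)

theory Submission imports Defs begin

section \<open>Graphs covered by regions\<close>

locale region_cover =
  fixes A :: "'a rel" and Rg :: "'a set set"
  assumes symA: "sym A"
    and cover: "(x, y) \<in> A \<Longrightarrow> \<exists>\<rho>\<in>Rg. x \<in> \<rho> \<and> y \<in> \<rho>"
begin

section \<open>Reachability and connectedness inside a vertex set\<close>

definition reach :: "'a set \<Rightarrow> 'a \<Rightarrow> 'a \<Rightarrow> bool" where
  "reach S x y \<longleftrightarrow> (x, y) \<in> rtrancl_on S A"

text \<open>The empty set satisfies this, so nonemptiness of branch sets has to be recorded
  separately.\<close>

definition conn :: "'a set \<Rightarrow> bool" where
  "conn S \<longleftrightarrow> (\<forall>x\<in>S. \<forall>y\<in>S. reach S x y)"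

lemma reach_refl: "x \<in> S \<Longrightarrow> reach S x x"
  by (simp add: reach_def)

lemma reach_in: "reach S x y \<Longrightarrow> x \<in> S" "reach S x y \<Longrightarrow> y \<in> S"
  unfolding reach_def by (auto dest: in_rtrancl_on_in_F)

lemma reach_trans: "reach S x y \<Longrightarrow> reach S y z \<Longrightarrow> reach S x z"
  unfolding reach_def by (rule rtrancl_on_trans)

lemma reach_sym: "reach S x y \<Longrightarrow> reach S y x"
  unfolding reach_def using rtrancl_on_sym[OF symA] by (metis symD)

lemma reach_mono: "reach S x y \<Longrightarrow> S \<subseteq> T \<Longrightarrow> reach T x y"
  unfolding reach_def by (rule rtrancl_on_mono) auto

lemma reach_edge: "(x, y) \<in> A \<Longrightarrow> x \<in> S \<Longrightarrow> y \<in> S \<Longrightarrow> reach S x y"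
  unfolding reach_def by (blast intro: rtrancl_on_into_rtrancl_on)

text \<open>Every initial part of a walk from \<open>x\<close> stays in the component of
  \<open>x\<close>, so the component is connected using its own vertices only.\<close>

lemma reach_component: "reach S x y \<Longrightarrow> reach {z. reach S x z} x y"
proof -
  assume "reach S x y"
  then show ?thesis
    unfolding reach_def
  proof (induction rule: rtrancl_on_induct)
    case base
    then show ?case by auto
  next
    case (step y z)
    then have "(x, z) \<in> rtrancl_on S A" by (blast intro: rtrancl_on_into_rtrancl_on)
    with step show ?case by (blast intro: rtrancl_on_into_rtrancl_on)
  qed
qed

lemma conn_component: "conn {z. reach S x z}"
  unfolding conn_def by (auto intro: reach_trans[OF reach_sym[OF reach_component] reach_component])

text \<open>The first arc of the walk that leaves \<open>Z\<close> is \<open>(u, v)\<close>;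
  everything before it stays in \<open>Z\<close>. If no reachable vertex had such an arc, the whole
  walk would stay in \<open>Z\<close>.\<close>

lemma reach_exit:
  assumes "reach S x y" "x \<in> Z" "y \<notin> Z"
  obtains u v where "reach (S \<inter> Z) x u" "(u, v) \<in> A" "v \<in> S" "v \<notin> Z"
proof (rule ccontr)
  assume no: "\<not> thesis"
  have "(x, w) \<in> rtrancl_on S A \<Longrightarrow> (x, w) \<in> rtrancl_on (S \<inter> Z) A" for w
  proof (induction rule: rtrancl_on_induct)
    case base
    then show ?case using assms(2) by auto
  next
    case (step y z)
    with no that have "z \<in> Z" unfolding reach_def by blast
    with step show ?case by (auto intro: rtrancl_on_into_rtrancl_on)
  qed
  then have "y \<in> S \<inter> Z" using assms(1) unfolding reach_def by (meson in_rtrancl_on_in_F(2))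
  with assms(3) show False by simp
qed

lemma conn_reach: "conn S \<Longrightarrow> x \<in> S \<Longrightarrow> y \<in> S \<Longrightarrow> reach S x y"
  by (simp add: conn_def)

lemma conn_from: "x \<in> S \<Longrightarrow> (\<And>y. y \<in> S \<Longrightarrow> reach S x y) \<Longrightarrow> conn S"
  unfolding conn_def by (meson reach_sym reach_trans)

lemma conn_Un:
  assumes "conn S" "conn T" "x \<in> S" "y \<in> T" "x = y \<or> (x, y) \<in> A"
  shows "conn (S \<union> T)"
proof (rule conn_from[of x])
  fix z assume "z \<in> S \<union> T"
  moreover have "reach (S \<union> T) x z" if "z \<in> S"
    using reach_mono[OF conn_reach[OF assms(1,3) that]] by blast
  moreover have "reach (S \<union> T) x z" if "z \<in> T"
  proof -
    have "reach (S \<union> T) y z" using reach_mono[OF conn_reach[OF assms(2,4) that]] by blast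
    moreover have "reach (S \<union> T) x y" using assms by (auto intro: reach_refl reach_edge)
    ultimately show ?thesis by (meson reach_trans)
  qed
  ultimately show "reach (S \<union> T) x z" by blast
qed (use assms in auto)

section \<open>The metric counting regions\<close>

text \<open>Lying in a common region is not enough: the ends must be joined inside
  \<open>S \<inter> \<rho>\<close>. A step thus carries a walk in \<open>S\<close>, and shrinking
  \<open>S\<close> can only increase distances. The reflexive case turns powers into "distance at
  most \<open>n\<close>".\<close>

definition step :: "'a set \<Rightarrow> 'a rel" where
  "step S = {(x, y). x \<in> S \<and> y \<in> S \<and> (x = y \<or> (\<exists>\<rho>\<in>Rg. reach (S \<inter> \<rho>) x y))}"

text \<open>Membership of \<open>x\<close> is required explicitly only for the sake of
  \<open>n = 0\<close>, where the relation power is the full identity.\<close>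

definition near :: "'a set \<Rightarrow> nat \<Rightarrow> 'a \<Rightarrow> 'a \<Rightarrow> bool" where
  "near S n x y \<longleftrightarrow> x \<in> S \<and> (x, y) \<in> step S ^^ n"

lemma step_reach: "(x, y) \<in> step S \<Longrightarrow> reach S x y"
  unfolding step_def by (auto intro: reach_refl reach_mono)

lemma step_sym: "(x, y) \<in> step S \<Longrightarrow> (y, x) \<in> step S"
  unfolding step_def by (auto intro: reach_sym)

lemma step_mono: "S \<subseteq> T \<Longrightarrow> step S \<subseteq> step T"
  unfolding step_def by (auto, meson Int_mono order_refl reach_mono)

lemma edge_step: "(x, y) \<in> A \<Longrightarrow> x \<in> S \<Longrightarrow> y \<in> S \<Longrightarrow> (x, y) \<in> step S"
  using cover[of x y] unfolding step_def by (auto intro: reach_edge)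

lemma near_reach: "near S n x y \<Longrightarrow> reach S x y"
  unfolding near_def
proof (induction n arbitrary: y)
  case 0
  then show ?case by (auto simp: reach_refl)
next
  case (Suc n)
  then obtain z where "(x, z) \<in> step S ^^ n" "(z, y) \<in> step S" by auto
  with Suc show ?case by (blast intro: reach_trans step_reach)
qed

lemma near_in: "near S n x y \<Longrightarrow> x \<in> S" "near S n x y \<Longrightarrow> y \<in> S"
  using near_reach reach_in by blast+

lemma near_0: "near S 0 x y \<longleftrightarrow> x \<in> S \<and> x = y"
  by (auto simp: near_def)

lemma near_step: "(x, y) \<in> step S \<Longrightarrow> near S 1 x y"
  by (auto simp: near_def step_def)

lemma near_trans: "near S m x y \<Longrightarrow> near S n y z \<Longrightarrow> near S (m + n) x z"
  unfolding near_def relpow_add by blast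

lemma near_Suc: "near S n x y \<Longrightarrow> (y, z) \<in> step S \<Longrightarrow> near S (Suc n) x z"
  unfolding near_def by auto

lemma near_mono:
  assumes "near S m x y" "m \<le> n" "S \<subseteq> T"
  shows "near T n x y"
proof -
  have "near T m x y"
    using assms(1)
  proof (induction m arbitrary: y)
    case 0
    then show ?case using assms(3) by (auto simp: near_0)
  next
    case (Suc m)
    then obtain z where "near S m x z" "(z, y) \<in> step S" by (auto simp: near_def)
    then show ?case using Suc.IH step_mono[OF assms(3)] by (blast intro: near_Suc)
  qed
  moreover have "near T k y y" for k
  proof (induction k)
    case 0
    then show ?case using near_in(2)[OF calculation] by (simp add: near_0)
  next
    case (Suc k)
    then show ?case using near_in(2)[OF calculation] by (auto simp: step_def intro: near_Suc[of T k y y])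
  qed
  ultimately show ?thesis using near_trans[of T m x y "n - m" y] assms(2) by simp
qed

lemma near_sym: "near S n x y \<Longrightarrow> near S n y x"
proof (induction n arbitrary: y)
  case 0
  then show ?case by (auto simp: near_0)
next
  case (Suc n)
  from Suc.prems obtain z where z: "near S n x z" "(z, y) \<in> step S" by (auto simp: near_def)
  from near_trans[OF near_step[OF step_sym[OF z(2)]] Suc.IH[OF z(1)]] show ?case by simp
qed

lemma reach_near: "reach S x y \<Longrightarrow> \<exists>n. near S n x y"
  unfolding reach_def
proof (induction rule: rtrancl_on_induct)
  case base
  then show ?case using near_0 by blast
next
  case (step y z)
  then show ?case by (meson edge_step near_Suc)
qed

section \<open>Levels around a root\<close>

text \<open>This is the distance from \<open>r\<close> in the metric of \<open>S\<close>. For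
  \<open>x\<close> not reachable from \<open>r\<close> the value is unspecified, so the facts about
  it assume \<open>conn S\<close> and membership.\<close>

definition lev :: "'a set \<Rightarrow> 'a \<Rightarrow> 'a \<Rightarrow> nat" where
  "lev S r x = (LEAST n. near S n r x)"

lemma lev_le_iff:
  assumes "conn S" "r \<in> S" "x \<in> S"
  shows "lev S r x \<le> n \<longleftrightarrow> near S n r x"
proof -
  have "near S (lev S r x) r x"
    unfolding lev_def using reach_near[OF conn_reach[OF assms]] by (rule LeastI_ex)
  then show ?thesis
    using near_mono[of S "lev S r x" r x n S] Least_le[of "\<lambda>n. near S n r x" n] unfolding lev_def by blast
qed

lemma lev_near:
  assumes "conn S" "r \<in> S" "near S n x y"
  shows "lev S r y \<le> lev S r x + n"
proof -
  have "near S (lev S r x) r x" using lev_le_iff[OF assms(1,2) near_in(1)[OF assms(3)]] by blast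
  from near_trans[OF this assms(3)] show ?thesis
    using lev_le_iff[OF assms(1,2) near_in(2)[OF assms(3)]] by blast
qed

lemma lev_step:
  assumes "conn S" "r \<in> S" "(x, y) \<in> step S"
  shows "lev S r y \<le> lev S r x + 1"
  using lev_near[OF assms(1,2) near_step[OF assms(3)]] .

lemma lev_root: "conn S \<Longrightarrow> r \<in> S \<Longrightarrow> lev S r x = 0 \<and> x \<in> S \<longleftrightarrow> x = r"
  using lev_le_iff[of S r x 0] by (auto simp: near_0)


subsection \<open>Nested annuli and the colouring\<close>

definition annulus :: "'a set \<Rightarrow> 'a \<Rightarrow> nat \<Rightarrow> 'a set" where
  "annulus S r a = {x \<in> S. a \<le> lev S r x \<and> lev S r x \<le> a + 2}"

text \<open>Each round picks a root, three consecutive layers and one component of them. Root and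
  layers are arbitrary here; the colouring makes a particular choice, while the minor construction
  works for all of them.\<close>

inductive chain :: "nat \<Rightarrow> 'a set \<Rightarrow> 'a set \<Rightarrow> bool" where
  chain_0: "conn S \<Longrightarrow> chain 0 S S"
| chain_Suc: "conn S \<Longrightarrow> r \<in> S \<Longrightarrow> x \<in> annulus S r a \<Longrightarrow>
    chain n {z. reach (annulus S r a) x z} K \<Longrightarrow> chain (Suc n) S K"

lemma chain_conn: "chain n S K \<Longrightarrow> conn S" "chain n S K \<Longrightarrow> conn K" "chain n S K \<Longrightarrow> K \<subseteq> S"
  by (induction rule: chain.induct) (auto dest!: reach_in(2) simp: annulus_def)

text \<open>The colouring depends on the ambient set because the recursion colours each component of
  an annulus on its own. Only membership in a common last set of a chain is claimed; its diameter is
  bounded later by means of the excluded minor.\<close>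

lemma chain_coloring:
  "\<exists>c :: 'a set \<Rightarrow> 'a \<Rightarrow> nat. (\<forall>S x. c S x < 2 ^ n) \<and>
     (\<forall>S x y. conn S \<longrightarrow> x \<in> S \<longrightarrow> (\<lambda>u v. (u, v) \<in> step S \<and> c S u = c S v)\<^sup>*\<^sup>* x y \<longrightarrow>
        (\<exists>K. chain n S K \<and> x \<in> K \<and> y \<in> K))"
proof (induction n)
  case 0
  have "y \<in> S" if "x \<in> S" "(\<lambda>u v. (u, v) \<in> step S \<and> 0 = (0::nat))\<^sup>*\<^sup>* x y" for S x y
    using that(2,1) by (induction rule: rtranclp_induct) (auto simp: step_def)
  then show ?case
    by (intro exI[of _ "\<lambda>_ _. 0"]) (auto intro: chain_0)
next
  case (Suc n)
  then obtain c :: "'a set \<Rightarrow> 'a \<Rightarrow> nat" where c: "\<And>S x. c S x < 2 ^ n"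
    and chain: "\<And>S x y. conn S \<Longrightarrow> x \<in> S \<Longrightarrow>
      (\<lambda>u v. (u, v) \<in> step S \<and> c S u = c S v)\<^sup>*\<^sup>* x y \<Longrightarrow> \<exists>K. chain n S K \<and> x \<in> K \<and> y \<in> K"
    by blast
  define root where "root S = (SOME r. r \<in> S)" for S :: "'a set"
  define l where "l S = lev S (root S)" for S
  define cp where "cp S x = {z. reach (annulus S (root S) (l S x - 1)) x z}" for S x
  \<comment> \<open>The last binary digit is the parity of the level, the remaining digits are the
    recursive colour, so each round doubles the number of colours.\<close>
  define d where "d S x = 2 * c (cp S x) x + l S x mod 2" for S x
  have "d S x < 2 ^ Suc n" for S x
    using c[of "cp S x" x] mod_less_divisor[of 2 "l S x"] unfolding d_def power_Suc by linarith
  moreover have "\<exists>K. chain (Suc n) S K \<and> x \<in> K \<and> y \<in> K"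
    if S: "conn S" "x \<in> S" and xy: "(\<lambda>u v. (u, v) \<in> step S \<and> d S u = d S v)\<^sup>*\<^sup>* x y" for S x y
  proof -
    have root: "root S \<in> S" unfolding root_def using S(2) by (rule someI)
    \<comment> \<open>The margin of one layer on each side keeps every step between equally coloured vertices of the
      middle layer inside the component; at level \<open>0\<close> the truncated subtraction is harmless.\<close>
    have x_in: "x \<in> annulus S (root S) (l S x - 1)"
      using S by (auto simp: annulus_def l_def)
    have one: "(u, v) \<in> step (cp S u)" "cp S u = cp S v" "c (cp S u) u = c (cp S v) v"
      if uv: "(u, v) \<in> step S" "d S u = d S v" for u v
    proof -
      have mod: "l S u mod 2 = l S v mod 2" using uv(2) unfolding d_def by presburger
      have "l S v \<le> l S u + 1" "l S u \<le> l S v + 1"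
        using lev_step[OF S(1) root] uv(1) step_sym unfolding l_def by blast+
      \<comment> \<open>A step changes the level by at most one, so equal parity forces equal
        levels.\<close>
      with mod have lv: "l S u = l S v" by presburger
      let ?B = "annulus S (root S) (l S u - 1)"
      have uS: "u \<in> S" using uv(1) by (auto simp: step_def)
      then have uB: "u \<in> ?B" by (auto simp: annulus_def l_def)
      have cpu: "cp S u = {z. reach ?B u z}" by (simp add: cp_def)
      show st: "(u, v) \<in> step (cp S u)"
      proof (cases "u = v")
        case True
        moreover have "u \<in> cp S u" using reach_refl[OF uB] by (simp add: cpu)
        ultimately show ?thesis by (simp add: step_def)
      next
        case False
        then obtain \<rho> where \<rho>: "\<rho> \<in> Rg" "reach (S \<inter> \<rho>) u v" using uv(1) by (auto simp: step_def)
        \<comment> \<open>Every vertex of \<open>?D\<close> is a single step of \<open>S\<close>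
          away from \<open>u\<close>, hence within one level of it. The walk witnessing the step
          therefore survives inside the annulus.\<close>
        let ?D = "{z. reach (S \<inter> \<rho>) u z}"
        have D: "?D \<subseteq> ?B"
        proof
          fix z assume "z \<in> ?D"
          then have "(u, z) \<in> step S" using \<rho>(1) reach_in by (fastforce simp: step_def)
          then have "l S z \<le> l S u + 1" "l S u \<le> l S z + 1" "z \<in> S"
            using lev_step[OF S(1) root] step_sym unfolding l_def by (blast, blast, auto simp: step_def)
          then show "z \<in> ?B" by (auto simp: annulus_def l_def)
        qed
        have uvD: "reach ?D u v" using reach_component[OF \<rho>(2)] .
        have DC: "?D \<subseteq> cp S u \<inter> \<rho>"
        proof
          fix z assume "z \<in> ?D"
          then have "reach (S \<inter> \<rho>) u z" by simp
          from reach_mono[OF reach_component[OF this] D] reach_in(2)[OF this]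
          show "z \<in> cp S u \<inter> \<rho>" by (auto simp: cpu)
        qed
        from reach_mono[OF uvD DC] \<rho>(1) show ?thesis
          using reach_in[of "cp S u \<inter> \<rho>" u v] by (auto simp: step_def)
      qed
      then have "reach ?B u v" by (auto simp: step_def cpu)
      then show eq: "cp S u = cp S v"
        unfolding cp_def lv[symmetric] using reach_trans reach_sym by blast
      show "c (cp S u) u = c (cp S v) v"
        using uv(2) mod unfolding d_def by linarith
    qed
    \<comment> \<open>The component does not change along the walk, so the walk is also
      monochromatic for the recursive colouring of this one component.\<close>
    have "cp S y = cp S x \<and> (\<lambda>u v. (u, v) \<in> step (cp S x) \<and> c (cp S x) u = c (cp S x) v)\<^sup>*\<^sup>* x y"
      using xy
    proof (induction rule: rtranclp_induct)
      case base
      then show ?case by simp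
    next
      case (step y z)
      with one[of y z] show ?case by (auto intro: rtranclp.rtrancl_into_rtrancl)
    qed
    moreover have "conn (cp S x)" "x \<in> cp S x"
      using x_in reach_refl by (auto simp: cp_def conn_component)
    ultimately obtain K where "chain n (cp S x) K" "x \<in> K" "y \<in> K"
      using chain by blast
    then show ?thesis
      using chain_Suc[OF S(1) root x_in] unfolding cp_def by blast
  qed
  ultimately show ?case by blast
qed

subsection \<open>Descending walks\<close>

text \<open>The last step of a shortest route from \<open>r\<close> to \<open>x\<close> runs through
  one region. Its walk, read backwards from \<open>x\<close>, is cut at the first vertex
  \<open>v\<close> off level \<open>Suc n\<close>; \<open>Q\<close> is the component of
  \<open>x\<close> in that level within the region.\<close>

lemma descend_step:
  assumes S: "conn S" "r \<in> S" and x: "x \<in> S" "lev S r x = Suc n"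
  obtains Q u v where "conn Q" "x \<in> Q" "u \<in> Q" "Q \<subseteq> S" "\<And>z. z \<in> Q \<Longrightarrow> lev S r z = Suc n"
    "\<And>z. z \<in> Q \<Longrightarrow> near Q 1 x z" "(u, v) \<in> A" "v \<in> S" "lev S r v = n" "(x, v) \<in> step (insert v Q)"
proof -
  have "near S (Suc n) r x" using lev_le_iff[OF S x(1)] x(2) by (metis order_refl)
  then obtain y where y: "near S n r y" "(y, x) \<in> step S" by (auto simp: near_def)
  then have yS: "y \<in> S" using near_in by blast
  have "lev S r y \<le> n" using lev_le_iff[OF S yS] y(1) by blast
  then have ly: "lev S r y = n" using lev_step[OF S y(2)] x(2) by simp
  with x y(2) obtain \<rho> where \<rho>: "\<rho> \<in> Rg" "reach (S \<inter> \<rho>) y x" by (auto simp: step_def)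
  let ?Z = "{z. lev S r z = Suc n}"
  have "reach (S \<inter> \<rho>) x y" "x \<in> ?Z" "y \<notin> ?Z" using reach_sym \<rho> x ly by auto
  then obtain u v where uv: "reach (S \<inter> \<rho> \<inter> ?Z) x u" "(u, v) \<in> A" "v \<in> S \<inter> \<rho>" "v \<notin> ?Z"
    by (rule reach_exit)
  let ?Q = "{z. reach (S \<inter> \<rho> \<inter> ?Z) x z}"
  have "reach (S \<inter> \<rho>) x v"
    using reach_mono[OF uv(1), of "S \<inter> \<rho>"] reach_edge[OF uv(2), of "S \<inter> \<rho>"] uv(3) reach_in(2)[OF uv(1)]
    by (auto intro: reach_trans)
  then have "(x, v) \<in> step S" "(v, y) \<in> step S"
    using \<rho> reach_trans[OF reach_sym[of _ x v] reach_sym[OF \<rho>(2)]] x(1) yS uv(3)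
    by (auto simp: step_def)
  \<comment> \<open>\<open>v\<close> is one step from \<open>x\<close> at level \<open>Suc n\<close>
    and one step from \<open>y\<close> at level \<open>n\<close>, and it is not at level
    \<open>Suc n\<close>.\<close>
  then have "lev S r v = n"
    using lev_step[OF S step_sym, of x v] lev_step[OF S step_sym, of v y] x(2) ly uv(4) by auto
  moreover have xQ: "x \<in> ?Q" using uv(1) reach_in reach_refl by blast
  moreover have Q\<rho>: "reach (?Q \<inter> \<rho>) x z" if "z \<in> ?Q" for z
  proof -
    have "reach (S \<inter> \<rho> \<inter> ?Z) x z" using that by simp
    from reach_component[OF this] show ?thesis by (rule reach_mono) (auto dest: reach_in(2))
  qed
  moreover have "near ?Q 1 x z" if "z \<in> ?Q" for z
    using Q\<rho>[OF that] \<rho>(1) xQ that by (intro near_step) (auto simp: step_def)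
  moreover have "(x, v) \<in> step (insert v ?Q)"
  proof -
    have u: "u \<in> ?Q" using uv(1) by simp
    have "reach (insert v ?Q \<inter> \<rho>) x u" using Q\<rho>[OF u] by (rule reach_mono) auto
    moreover have "reach (insert v ?Q \<inter> \<rho>) u v"
      using uv(2) by (rule reach_edge) (use u uv(3) reach_in(2)[OF uv(1)] in auto)
    ultimately have "reach (insert v ?Q \<inter> \<rho>) x v" by (rule reach_trans)
    with \<rho>(1) xQ show ?thesis by (auto simp: step_def)
  qed
  ultimately show ?thesis
    using uv by (intro that[of ?Q u v]) (auto simp: conn_component dest: reach_in(2))
qed

text \<open>One-level descents are concatenated, each costing one step. Distances are measured in
  \<open>Q\<close> itself, so they remain valid in any set containing \<open>Q\<close>, in
  particular in an inner annulus component. The vertex \<open>v\<close> at level \<open>b\<close> is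
  left outside \<open>Q\<close>.\<close>

lemma descend:
  assumes S: "conn S" "r \<in> S" and x: "x \<in> S" "b < lev S r x"
  obtains Q u v where "conn Q" "x \<in> Q" "u \<in> Q" "Q \<subseteq> S"
    "\<And>z. z \<in> Q \<Longrightarrow> b < lev S r z \<and> lev S r z \<le> lev S r x"
    "\<And>z. z \<in> Q \<Longrightarrow> near Q (lev S r x - b) x z" "(u, v) \<in> A" "v \<in> S" "lev S r v = b"
proof -
  have "\<exists>Q u v. conn Q \<and> x \<in> Q \<and> u \<in> Q \<and> Q \<subseteq> S \<and>
      (\<forall>z\<in>Q. b < lev S r z \<and> lev S r z \<le> lev S r x \<and> near Q (lev S r x - b) x z) \<and>
      (u, v) \<in> A \<and> v \<in> S \<and> lev S r v = b"
    using x
  proof (induction "lev S r x - b" arbitrary: x)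
    case 0
    then show ?case by simp
  next
    case (Suc k)
    then obtain n where n: "lev S r x = Suc n" "b \<le> n" "k = n - b" by (cases "lev S r x") auto
    obtain Q u v where Q: "conn Q" "x \<in> Q" "u \<in> Q" "Q \<subseteq> S" "\<And>z. z \<in> Q \<Longrightarrow> lev S r z = Suc n"
      "\<And>z. z \<in> Q \<Longrightarrow> near Q 1 x z" "(u, v) \<in> A" "v \<in> S" "lev S r v = n" "(x, v) \<in> step (insert v Q)"
      using descend_step[OF S Suc.prems(1) n(1)] by blast
    show ?case
    proof (cases "b = n")
      case True
      then show ?thesis using Q n by (intro exI[of _ Q] exI[of _ u] exI[of _ v]) auto
    next
      case False
      then have "k = lev S r v - b" "b < lev S r v" using n Q(9) by auto
      from Suc.hyps(1)[OF this(1) Q(8) this(2)]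
      obtain Q' u' v' where Q': "conn Q'" "v \<in> Q'" "u' \<in> Q'" "Q' \<subseteq> S"
        "\<And>z. z \<in> Q' \<Longrightarrow> b < lev S r z \<and> lev S r z \<le> n \<and> near Q' (n - b) v z"
        "(u', v') \<in> A" "v' \<in> S" "lev S r v' = b"
        unfolding Q(9) by blast
      let ?Q = "Q \<union> Q'"
      have "conn ?Q" using conn_Un[OF Q(1) Q'(1) Q(3) Q'(2)] Q(7) by blast
      moreover have "near ?Q (Suc n - b) x z" if "z \<in> Q'" for z
      proof -
        have "near ?Q 1 x v"
          using near_mono[OF near_step[OF Q(10)] order_refl] Q'(2) by blast
        have "near ?Q (n - b) v z" using near_mono Q'(5)[OF that] by blast
        from near_trans[OF \<open>near ?Q 1 x v\<close> this] show ?thesis using n by (simp add: Suc_diff_le)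
      qed
      moreover have "near ?Q (Suc n - b) x z" if "z \<in> Q" for z
        using near_mono[OF Q(6)[OF that], of "Suc n - b" ?Q] n by auto
      moreover have "b < lev S r z \<and> lev S r z \<le> Suc n" if "z \<in> ?Q" for z
        using that Q(5) Q'(5) n False by (fastforce)
      ultimately have "conn ?Q \<and> x \<in> ?Q \<and> u' \<in> ?Q \<and> ?Q \<subseteq> S \<and>
          (\<forall>z\<in>?Q. b < lev S r z \<and> lev S r z \<le> lev S r x \<and> near ?Q (lev S r x - b) x z) \<and>
          (u', v') \<in> A \<and> v' \<in> S \<and> lev S r v' = b"
        using Q Q' n by (intro conjI) auto
      then show ?thesis by blast
    qed
  qed
  then show ?thesis using that by blast
qed

text \<open>A descent to level \<open>0\<close> never rises above its starting level and ends at the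
  root, the only vertex of level \<open>0\<close>.\<close>

lemma conn_sublevel:
  assumes S: "conn S" "r \<in> S"
  shows "conn {z \<in> S. lev S r z \<le> n}"
proof -
  have r: "lev S r r = 0" using lev_root[OF S, of r] S(2) by simp
  have "reach {z \<in> S. lev S r z \<le> n} x r" if x: "x \<in> S" "lev S r x \<le> n" for x
  proof (cases "lev S r x = 0")
    case True
    then have "x = r" using lev_root[OF S, of x] x(1) by simp
    then show ?thesis using S(2) r by (auto intro: reach_refl)
  next
    case False
    then have "0 < lev S r x" by simp
    then obtain Q u v where Q: "conn Q" "x \<in> Q" "u \<in> Q" "Q \<subseteq> S"
      "\<And>z. z \<in> Q \<Longrightarrow> 0 < lev S r z \<and> lev S r z \<le> lev S r x"
      "(u, v) \<in> A" "v \<in> S" "lev S r v = 0"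
      by (rule descend[OF S x(1)]) blast
    have v: "v = r" using lev_root[OF S, of v] Q(7,8) by simp
    have sub: "Q \<subseteq> {z \<in> S. lev S r z \<le> n}" using Q(4,5) x(2) by force
    have "reach {z \<in> S. lev S r z \<le> n} x u"
      using reach_mono[OF conn_reach[OF Q(1-3)] sub] .
    moreover have "reach {z \<in> S. lev S r z \<le> n} u r"
      using Q(3,6) sub S(2) r by (intro reach_edge) (auto simp: v)
    ultimately show ?thesis by (rule reach_trans)
  qed
  then show ?thesis
    using S(2) r by (intro conn_from[of r]) (auto intro: reach_sym)
qed

subsection \<open>Building the minor\<close>

text \<open>The sets \<open>B i\<close> come from the rounds, the legs \<open>T j\<close> grow out of the points \<open>p j\<close>, and \<open>z j\<close> is the
  place where the leg is extended in the next round; the clear \<open>3\<close>-ball around it is what the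
  descent through the three layers of the next annulus needs.\<close>

definition legs where
  "legs n S K J p B T z \<longleftrightarrow>
    (\<forall>i<n. conn (B i) \<and> B i \<subseteq> S \<and> B i \<inter> K = {}) \<and>
    (\<forall>i<n. \<forall>k<n. i \<noteq> k \<longrightarrow> B i \<inter> B k = {}) \<and>
    (\<forall>j\<in>J. conn (T j) \<and> p j \<in> T j \<and> z j \<in> T j \<and> (\<forall>w\<in>T j. near S (12 * n) (p j) w)) \<and>
    (\<forall>j\<in>J. \<forall>i<n. B i \<inter> T j = {} \<and> (\<exists>u\<in>T j. \<exists>v\<in>B i. (u, v) \<in> A) \<and>
        (\<forall>w\<in>B i. \<not> near S 3 (z j) w))"

text \<open>The induction peels off the outermost round: the legs found in the inner component
  \<open>S'\<close> are extended down to a new ball around the root of \<open>S\<close>. Each round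
  lengthens a leg by at most \<open>12\<close>, so separation beyond \<open>24 * n\<close> keeps
  different legs disjoint. Two distinct points are demanded to force the annulus away from the
  root.\<close>

lemma chain_legs:
  fixes p :: "'i \<Rightarrow> 'a"
  assumes "chain n S K" "\<And>j. j \<in> J \<Longrightarrow> p j \<in> K"
    and "\<And>i j. i \<in> J \<Longrightarrow> j \<in> J \<Longrightarrow> i \<noteq> j \<Longrightarrow> \<not> near S (24 * n) (p i) (p j)"
    and "i0 \<in> J" "i1 \<in> J" "i0 \<noteq> i1"
  shows "\<exists>B T z. legs n S K J p B T z"
  using assms(1-3)
proof (induction rule: chain.induct)
  case (chain_0 S)
  have "reach {x} x x" for x by (simp add: reach_refl)
  with chain_0 show ?case
    by (intro exI[of _ undefined] exI[of _ "\<lambda>j. {p j}"] exI[of _ p])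
      (auto simp: legs_def conn_def near_0)
next
  case (chain_Suc S r x a n K)
  define S' where "S' = {z. reach (annulus S r a) x z}"
  note S = chain_Suc.hyps(1,2)
  have S'S: "S' \<subseteq> annulus S r a" using reach_in(2) by (auto simp: S'_def)
  have S': "z \<in> S" "a \<le> lev S r z" "lev S r z \<le> a + 2" if "z \<in> S'" for z
    using that S'S by (auto simp: annulus_def)
  have KS': "K \<subseteq> S'" using chain_conn(3)[OF chain_Suc.hyps(4)] by (simp add: S'_def)
  note pK = chain_Suc.prems(1) and far = chain_Suc.prems(2)
  have S'sub: "S' \<subseteq> S" using S' by blast
  have absorb: "Q \<subseteq> S'" if "conn Q" "w \<in> Q" "w \<in> S'" "Q \<subseteq> annulus S r a" for Q w
  proof
    fix z assume "z \<in> Q"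
    then have "reach (annulus S r a) w z" using reach_mono[OF conn_reach] that by blast
    moreover have "reach (annulus S r a) x w" using that(3) by (simp add: S'_def)
    ultimately show "z \<in> S'" using reach_trans by (auto simp: S'_def)
  qed
  \<comment> \<open>If \<open>a \<le> 7\<close>, then all of \<open>S'\<close> is at level at most
    \<open>9\<close>, and any two of the points are within \<open>18\<close> of each other.\<close>
  have a8: "8 \<le> a"
  proof (rule ccontr)
    assume "\<not> 8 \<le> a"
    have "near S 9 r (p j)" if "j \<in> J" for j
    proof -
      have "p j \<in> S'" using pK[OF that] KS' by blast
      then have "p j \<in> S" "lev S r (p j) \<le> 9" using S'[of "p j"] \<open>\<not> 8 \<le> a\<close> by auto
      then show ?thesis using lev_le_iff[OF S] by blast
    qed
    then have "near S (9 + 9) (p i0) (p i1)" using near_trans near_sym assms(4,5) by blast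
    then have "near S (24 * Suc n) (p i0) (p i1)" by (rule near_mono) auto
    then show False using far assms(4-6) by blast
  qed
  have "\<not> near S' (24 * n) (p i) (p j)" if "i \<in> J" "j \<in> J" "i \<noteq> j" for i j
    using far[OF that] near_mono[of S' "24 * n" "p i" "p j" "24 * Suc n" S] S'sub by auto
  then obtain B T z where legs: "legs n S' K J p B T z"
    using chain_Suc.IH[OF pK] unfolding S'_def[symmetric] by blast
  have B: "\<And>i. i < n \<Longrightarrow> conn (B i) \<and> B i \<subseteq> S' \<and> B i \<inter> K = {}"
    and BB: "\<And>i k. i < n \<Longrightarrow> k < n \<Longrightarrow> i \<noteq> k \<Longrightarrow> B i \<inter> B k = {}"
    and T: "\<And>j. j \<in> J \<Longrightarrow> conn (T j) \<and> p j \<in> T j \<and> z j \<in> T j \<and> (\<forall>w\<in>T j. near S' (12 * n) (p j) w)"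
    and BT: "\<And>j i. j \<in> J \<Longrightarrow> i < n \<Longrightarrow> B i \<inter> T j = {} \<and> (\<exists>u\<in>T j. \<exists>v\<in>B i. (u, v) \<in> A) \<and>
        (\<forall>w\<in>B i. \<not> near S' 3 (z j) w)"
    using legs unfolding legs_def by blast+
  \<comment> \<open>The new set. Descending from level \<open>a - 1\<close> to \<open>a - 8\<close>, the leg passes level \<open>a - 4\<close>, whose
    \<open>3\<close>-balls meet neither \<open>S'\<close> nor the new set.\<close>
  define C where "C = {w \<in> S. lev S r w \<le> a - 8}"
  have "\<exists>T' z'. conn T' \<and> T j \<subseteq> T' \<and> z' \<in> T' \<and> (\<forall>w\<in>T'. near S (12 * Suc n) (p j) w) \<and>
      (\<exists>u\<in>T'. \<exists>v\<in>C. (u, v) \<in> A) \<and> C \<inter> T' = {} \<and> (\<forall>w\<in>C. \<not> near S 3 z' w) \<and>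
      (\<forall>i<n. B i \<inter> T' = {} \<and> (\<forall>w\<in>B i. \<not> near S 3 z' w))" if j: "j \<in> J" for j
  proof -
    have TS': "T j \<subseteq> S'" using T[OF j] near_in(2) by blast
    have zS': "z j \<in> S'" using T[OF j] TS' by blast
    then have zS: "z j \<in> S" "a - 1 < lev S r (z j)" using S'[of "z j"] a8 by auto
    \<comment> \<open>The three descents have depth at most \<open>3\<close>, then \<open>3\<close>
      and \<open>4\<close>, as \<open>z j\<close> has level at most \<open>a + 2\<close>. With the
      two connecting arcs this adds up to \<open>12\<close>.\<close>
    obtain Q1 u1 v1 where Q1: "conn Q1" "z j \<in> Q1" "u1 \<in> Q1" "Q1 \<subseteq> S"
      "\<And>w. w \<in> Q1 \<Longrightarrow> a - 1 < lev S r w \<and> lev S r w \<le> lev S r (z j)"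
      "\<And>w. w \<in> Q1 \<Longrightarrow> near Q1 (lev S r (z j) - (a - 1)) (z j) w"
      "(u1, v1) \<in> A" "v1 \<in> S" "lev S r v1 = a - 1"
      by (rule descend[OF S zS]) blast
    have "a - 4 < lev S r v1" using Q1(9) a8 by simp
    then obtain Q2 u2 v2 where Q2: "conn Q2" "v1 \<in> Q2" "u2 \<in> Q2" "Q2 \<subseteq> S"
      "\<And>w. w \<in> Q2 \<Longrightarrow> a - 4 < lev S r w \<and> lev S r w \<le> lev S r v1"
      "\<And>w. w \<in> Q2 \<Longrightarrow> near Q2 (lev S r v1 - (a - 4)) v1 w"
      "(u2, v2) \<in> A" "v2 \<in> S" "lev S r v2 = a - 4"
      by (rule descend[OF S Q1(8)]) blast
    have "a - 8 < lev S r v2" using Q2(9) a8 by simp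
    then obtain Q3 u3 v3 where Q3: "conn Q3" "v2 \<in> Q3" "u3 \<in> Q3" "Q3 \<subseteq> S"
      "\<And>w. w \<in> Q3 \<Longrightarrow> a - 8 < lev S r w \<and> lev S r w \<le> lev S r v2"
      "\<And>w. w \<in> Q3 \<Longrightarrow> near Q3 (lev S r v2 - (a - 8)) v2 w"
      "(u3, v3) \<in> A" "v3 \<in> S" "lev S r v3 = a - 8"
      by (rule descend[OF S Q2(8)]) blast
    \<comment> \<open>The first descent stays at levels \<open>a\<close> to \<open>a + 2\<close> and
      meets \<open>S'\<close>, so it lies in that component. It is thus within the old clear
      \<open>3\<close>-ball of \<open>z j\<close>, measured in \<open>S'\<close>, and misses the old
      sets \<open>B i\<close>; the other two descents run below \<open>S'\<close>.\<close>
    have Q1S': "Q1 \<subseteq> S'"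
    proof (rule absorb[OF Q1(1,2) zS'])
      show "Q1 \<subseteq> annulus S r a"
        using Q1(4,5) S'(3)[OF zS'] by (force simp: annulus_def)
    qed
    have n1: "near Q1 3 (z j) w" if "w \<in> Q1" for w
      using near_mono[OF Q1(6)[OF that], of 3 Q1] S'(3)[OF zS'] a8 by auto
    have n1S: "near S (12 * n + 3) (p j) w" if "w \<in> Q1" for w
    proof -
      have "near S (12 * n) (p j) (z j)" using T[OF j] near_mono[of S' _ _ _ _ S] S'sub by blast
      moreover have "near S 3 (z j) w" using near_mono[OF n1[OF that] order_refl Q1(4)] .
      ultimately show ?thesis by (rule near_trans)
    qed
    have "near S (12 * n + 3) (p j) u1" using n1S Q1(3) .
    from near_Suc[OF this edge_step[OF Q1(7)]]
    have nv1: "near S (12 * n + 4) (p j) v1" using Q1(3,4,8) by (auto simp: add.commute)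
    have n2S: "near S (12 * n + 7) (p j) w" if "w \<in> Q2" for w
    proof -
      have "near S 3 v1 w" using near_mono[OF Q2(6)[OF that] _ Q2(4), of 3] Q1(9) a8 by simp
      from near_trans[OF nv1 this] show ?thesis by (simp add: add.commute)
    qed
    have "near S (12 * n + 7) (p j) u2" using n2S Q2(3) .
    from near_Suc[OF this edge_step[OF Q2(7)]]
    have nv2: "near S (12 * n + 8) (p j) v2" using Q2(3,4,8) by (auto simp: add.commute)
    have n3S: "near S (12 * n + 12) (p j) w" if "w \<in> Q3" for w
    proof -
      have "near S 4 v2 w" using near_mono[OF Q3(6)[OF that] _ Q3(4), of 4] Q2(9) a8 by simp
      from near_trans[OF nv2 this] show ?thesis by (simp add: add.commute)
    qed
    let ?T = "T j \<union> Q1 \<union> Q2 \<union> Q3"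
    have "conn (T j \<union> Q1)" using conn_Un[of "T j" Q1 "z j" "z j"] T[OF j] Q1 by blast
    then have "conn (T j \<union> Q1 \<union> Q2)" using conn_Un[of "T j \<union> Q1" Q2 u1 v1] Q1 Q2 by blast
    then have "conn ?T" using conn_Un[of "T j \<union> Q1 \<union> Q2" Q3 u2 v2] Q2 Q3 by blast
    moreover have "near S (12 * Suc n) (p j) w" if "w \<in> ?T" for w
    proof -
      have "near S (12 * n) (p j) w" if "w \<in> T j"
        using T[OF j] that near_mono[of S' _ _ _ _ S] S'sub by blast
      then have "\<exists>m \<le> 12 * n + 12. near S m (p j) w"
        using \<open>w \<in> ?T\<close> n1S[of w] n2S[of w] n3S[of w]
        by (auto intro: exI[of _ "12 * n"] exI[of _ "12 * n + 3"] exI[of _ "12 * n + 7"] exI[of _ "12 * n + 12"])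
      then show ?thesis using near_mono[of S _ "p j" w "12 * Suc n" S] by auto
    qed
    moreover have "\<exists>u\<in>?T. \<exists>v\<in>C. (u, v) \<in> A"
    proof -
      have "v3 \<in> C" using Q3(8,9) by (simp add: C_def)
      then show ?thesis using Q3(3,7) by blast
    qed
    moreover have lT: "a - 8 < lev S r w" if "w \<in> ?T" for w
    proof -
      have "w \<in> S' \<Longrightarrow> ?thesis" using S'(2)[of w] a8 by simp
      then show ?thesis using that TS' Q1(5)[of w] Q2(5)[of w] Q3(5)[of w] a8 by auto
    qed
    then have "C \<inter> ?T = {}" by (force simp: C_def)
    moreover have "\<not> near S 3 v2 w" if "w \<in> C" for w
    proof
      assume "near S 3 v2 w"
      from lev_near[OF S near_sym[OF this]] have "a - 4 \<le> lev S r w + 3" using Q2(9) by simp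
      moreover have "lev S r w \<le> a - 8" using that by (simp add: C_def)
      ultimately show False using a8 by linarith
    qed
    moreover have "B i \<inter> ?T = {}" if "i < n" for i
    proof -
      have "w \<notin> Q2 \<union> Q3" if "w \<in> S'" for w
        using S'(2)[OF that] Q2(5)[of w] Q3(5)[of w] Q1(9) Q2(9) a8 by auto
      moreover have "w \<notin> B i" if "w \<in> Q1" for w
        using near_mono[OF n1[OF that] order_refl Q1S'] BT[OF j \<open>i < n\<close>] by blast
      ultimately show ?thesis using B[OF that] BT[OF j that] by blast
    qed
    moreover have "\<not> near S 3 v2 w" if "w \<in> B i" "i < n" for w i
    proof
      assume "near S 3 v2 w"
      moreover have "w \<in> S'" using B that by blast
      ultimately have "a \<le> (a - 4) + 3" using lev_near[OF S, of 3 v2 w] S'(2)[of w] Q2(9) by simp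
      then show False using a8 by linarith
    qed
    ultimately show ?thesis using Q3(2) by (intro exI[of _ ?T] exI[of _ v2]) blast
  qed
  then obtain T' z' where T': "\<And>j. j \<in> J \<Longrightarrow> conn (T' j) \<and> T j \<subseteq> T' j \<and> z' j \<in> T' j \<and>
      (\<forall>w\<in>T' j. near S (12 * Suc n) (p j) w) \<and>
      (\<exists>u\<in>T' j. \<exists>v\<in>C. (u, v) \<in> A) \<and> C \<inter> T' j = {} \<and> (\<forall>w\<in>C. \<not> near S 3 (z' j) w) \<and>
      (\<forall>i<n. B i \<inter> T' j = {} \<and> (\<forall>w\<in>B i. \<not> near S 3 (z' j) w))"
    by metis
  have CS': "w \<notin> C" if "w \<in> S'" for w
  proof
    assume "w \<in> C"
    then have "lev S r w \<le> a - 8" by (simp add: C_def)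
    then show False using S'(2)[OF that] a8 by linarith
  qed
  have C: "conn C" unfolding C_def by (rule conn_sublevel[OF S])
  define B' where "B' i = (if i < n then B i else C)" for i
  have 1: "conn (B' i) \<and> B' i \<subseteq> S \<and> B' i \<inter> K = {}" for i
  proof (cases "i < n")
    case True
    then show ?thesis using B[OF True] S'sub by (auto simp: B'_def)
  next
    case False
    have "C \<subseteq> S" by (auto simp: C_def)
    then show ?thesis using False C CS' KS' by (auto simp: B'_def)
  qed
  have 2: "B' i \<inter> B' k = {}" if "i < Suc n" "k < Suc n" "i \<noteq> k" for i k
  proof -
    have "B i \<inter> C = {}" if "i < n" for i using B[OF that] CS' by blast
    then show ?thesis using that BB[of i k] by (auto simp: B'_def less_Suc_eq)
  qed
  have 3: "B' i \<inter> T' j = {} \<and> (\<exists>u\<in>T' j. \<exists>v\<in>B' i. (u, v) \<in> A) \<and>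
      (\<forall>w\<in>B' i. \<not> near S 3 (z' j) w)" if j: "j \<in> J" for i j
  proof (cases "i < n")
    case True
    have "T j \<subseteq> T' j" using T'[OF j] by blast
    moreover have "\<exists>u\<in>T j. \<exists>v\<in>B i. (u, v) \<in> A" using BT[OF j True] by blast
    ultimately have "\<exists>u\<in>T' j. \<exists>v\<in>B i. (u, v) \<in> A" by blast
    moreover have "\<forall>i<n. B i \<inter> T' j = {} \<and> (\<forall>w\<in>B i. \<not> near S 3 (z' j) w)"
      using T'[OF j] by (elim conjE)
    ultimately show ?thesis using True by (simp add: B'_def)
  next
    case False
    then show ?thesis using T'[OF j] by (simp add: B'_def)
  qed
  have 4: "conn (T' j) \<and> p j \<in> T' j \<and> z' j \<in> T' j \<and> (\<forall>w\<in>T' j. near S (12 * Suc n) (p j) w)"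
    if "j \<in> J" for j using T[OF that] T'[OF that] by blast
  have "legs (Suc n) S K J p B' T' z'"
    unfolding legs_def using 1 2 3 4 by blast
  then show ?case by blast
qed

section \<open>Assembling the clique minor\<close>

text \<open>The \<open>n + 2\<close> points are taken at levels
  \<open>0, N, ..., (n + 1) * N\<close> around \<open>x\<close>, where \<open>N = 24 * n + 1\<close>
  just exceeds the separation needed by the legs. Levels refer to the metric of \<open>S\<close>,
  although the points lie in \<open>K\<close>.\<close>

lemma chain_far_clique_minor:
  assumes ch: "chain n S K" and x: "x \<in> K" and y: "y \<in> K"
    and far: "\<not> near S ((n + 1) * (24 * n + 1)) x y"
  shows "\<exists>Z :: nat \<Rightarrow> 'a set. (\<forall>i<n+2. conn (Z i) \<and> Z i \<noteq> {} \<and> Z i \<subseteq> S) \<and>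
    (\<forall>i<n+2. \<forall>j<n+2. i \<noteq> j \<longrightarrow> Z i \<inter> Z j = {} \<and> (\<exists>u\<in>Z i. \<exists>v\<in>Z j. (u, v) \<in> A))"
proof -
  define N where "N = 24 * n + 1"
  define l where "l = lev S x"
  have S: "conn S" and K: "conn K" and KS: "K \<subseteq> S" using chain_conn[OF ch] by auto
  have xS: "x \<in> S" using x KS by blast
  have l0: "l x = 0" using lev_root[OF S xS, of x] xS by (simp add: l_def)
  have ly: "(n + 1) * N < l y"
    using far lev_le_iff[OF S xS, of y] y KS unfolding l_def N_def by (meson not_le subsetD)
  \<comment> \<open>A walk in \<open>K\<close> from \<open>x\<close> to \<open>y\<close> cannot skip
    a level. Its part up to the first arrival at level \<open>k\<close> stays at levels at most
    \<open>k\<close>, which later separates the link between \<open>p 0\<close> and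
    \<open>p 1\<close> from the other legs.\<close>
  have "\<exists>v. v \<in> K \<and> l v = k \<and> reach (K \<inter> {w. l w \<le> k}) x v" if "k < l y" for k
  proof (cases k)
    case 0
    then show ?thesis using x l0 by (intro exI[of _ x]) (auto intro: reach_refl)
  next
    case (Suc m)
    let ?Z = "{w. l w < k}"
    have "reach K x y" "x \<in> ?Z" "y \<notin> ?Z" using conn_reach[OF K x y] l0 Suc that by auto
    then obtain u v where uv: "reach (K \<inter> ?Z) x u" "(u, v) \<in> A" "v \<in> K" "v \<notin> ?Z"
      by (rule reach_exit)
    have u: "u \<in> K" "l u < k" using reach_in(2)[OF uv(1)] by auto
    have "l v \<le> l u + 1"
      unfolding l_def using lev_step[OF S xS edge_step[OF uv(2)]] u(1) uv(3) KS by blast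
    then have lv: "l v = k" using u(2) uv(4) by simp
    have "reach (K \<inter> {w. l w \<le> k}) x u" using uv(1) by (rule reach_mono) auto
    moreover have "reach (K \<inter> {w. l w \<le> k}) u v"
      using uv(2) by (rule reach_edge) (use u uv(3) lv in auto)
    ultimately show ?thesis using uv(3) lv reach_trans by blast
  qed
  then obtain f where f: "\<And>k. k < l y \<Longrightarrow> f k \<in> K \<and> l (f k) = k \<and> reach (K \<inter> {w. l w \<le> k}) x (f k)"
    by metis
  define p where "p j = f (j * N)" for j
  have p: "p j \<in> K" "l (p j) = j * N" "reach (K \<inter> {w. l w \<le> j * N}) x (p j)" if "j < n + 2" for j
  proof -
    have "j * N \<le> (n + 1) * N" using that by (intro mult_le_mono) auto
    then have "j * N < l y" using ly by simp
    from f[OF this] show "p j \<in> K" "l (p j) = j * N" "reach (K \<inter> {w. l w \<le> j * N}) x (p j)"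
      by (auto simp: p_def)
  qed
  have lnear: "l v \<le> l u + k" if "near S k u v" for u v k
    unfolding l_def by (rule lev_near[OF S xS that])
  have lt: "\<not> near S (24 * n) (p i) (p j)" if "i < j" "j < n + 2" for i j
  proof
    assume "near S (24 * n) (p i) (p j)"
    from lnear[OF this] have "j * N \<le> i * N + 24 * n" using p(2) that by simp
    moreover have "(i + 1) * N \<le> j * N" using that by (intro mult_le_mono) auto
    ultimately show False by (simp add: N_def)
  qed
  have pfar: "\<not> near S (24 * n) (p i) (p j)" if "i \<in> {..<n+2}" "j \<in> {..<n+2}" "i \<noteq> j" for i j
    using that lt[of i j] lt[of j i] near_sym[of S _ "p i" "p j"] by (cases i j rule: linorder_cases) auto
  have "(0::nat) \<in> {..<n+2}" "(1::nat) \<in> {..<n+2}" "(0::nat) \<noteq> 1" by auto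
  from chain_legs[where p = p and J = "{..<n+2}", OF ch _ pfar this] p(1)
  obtain B T z where legs: "legs n S K {..<n+2} p B T z" by blast
  have B: "conn (B i) \<and> B i \<subseteq> S \<and> B i \<inter> K = {}" if "i < n" for i
    using legs that unfolding legs_def by blast
  have BB: "B i \<inter> B k = {}" if "i < n" "k < n" "i \<noteq> k" for i k
    using legs that unfolding legs_def by blast
  have T: "conn (T j) \<and> p j \<in> T j \<and> (\<forall>w\<in>T j. near S (12 * n) (p j) w)" if "j < n + 2" for j
    using legs that unfolding legs_def by blast
  have BT: "B i \<inter> T j = {} \<and> (\<exists>u\<in>T j. \<exists>v\<in>B i. (u, v) \<in> A)" if "j < n + 2" "i < n" for j i
    using legs that unfolding legs_def by blast
  have TT: "T i \<inter> T j = {}" if "i < n + 2" "j < n + 2" "i \<noteq> j" for i j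
  proof (rule ccontr)
    assume "T i \<inter> T j \<noteq> {}"
    then obtain w where w: "w \<in> T i" "w \<in> T j" by blast
    have "near S (12 * n) (p i) w" "near S (12 * n) (p j) w"
      using T[OF that(1)] T[OF that(2)] w by blast+
    from near_trans[OF this(1) near_sym[OF this(2)]] show False using pfar that by simp
  qed
  have TS: "T j \<subseteq> S" if "j < n + 2" for j using T[OF that] near_in(2) by blast
  \<comment> \<open>\<open>Q\<close> links \<open>p 0\<close> to \<open>p 1\<close>. It misses each
    \<open>B i\<close> because it lies in \<open>K\<close>, and each leg \<open>T j\<close> with
    \<open>j \<ge> 2\<close> because such a leg has levels at least
    \<open>2 * N - 12 * n > N\<close>.\<close>
  define Q where "Q = {w. reach (K \<inter> {w. l w \<le> N}) x w}"
  have Q: "conn Q" "p 0 \<in> Q" "p 1 \<in> Q" "Q \<subseteq> K" "\<And>w. w \<in> Q \<Longrightarrow> l w \<le> N"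
  proof -
    have "reach (K \<inter> {w. l w \<le> 0 * N}) x (p 0)" using p(3)[of 0] by simp
    then have "reach (K \<inter> {w. l w \<le> N}) x (p 0)" by (rule reach_mono) auto
    then show "p 0 \<in> Q" by (simp add: Q_def)
    show "p 1 \<in> Q" using p(3)[of 1] by (simp add: Q_def)
    show "conn Q" by (simp add: Q_def conn_component)
    show "Q \<subseteq> K" "\<And>w. w \<in> Q \<Longrightarrow> l w \<le> N"
      by (auto simp: Q_def dest: reach_in(2))
  qed
  have QT: "Q \<inter> T j = {}" if "2 \<le> j" "j < n + 2" for j
  proof (rule ccontr)
    assume "Q \<inter> T j \<noteq> {}"
    then obtain w where w: "w \<in> Q" "w \<in> T j" by blast
    have "l w \<le> N" "near S (12 * n) (p j) w" using Q(5) T[OF that(2)] w by blast+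
    with lnear[OF near_sym[OF this(2)]] have "j * N \<le> N + 12 * n" using p(2)[OF that(2)] by simp
    moreover have "2 * N \<le> j * N" using that by (intro mult_le_mono) auto
    ultimately show False by (simp add: N_def)
  qed
  let ?U = "T 0 \<union> Q \<union> T 1"
  have T0: "conn (T 0)" "p 0 \<in> T 0" and T1: "conn (T 1)" "p 1 \<in> T 1" using T by auto
  have "conn (T 0 \<union> Q)" using conn_Un[OF T0(1) Q(1) T0(2) Q(2)] by blast
  then have U: "conn ?U" using conn_Un[of "T 0 \<union> Q" "T 1" "p 1" "p 1"] T1 Q(3) by blast
  \<comment> \<open>\<open>Q\<close> may run through \<open>T 0\<close>, so the connected set
    \<open>?U\<close> is split: \<open>W\<close> is the component of \<open>p 1\<close> after
    \<open>T 0\<close> is removed. It contains \<open>T 1\<close>, and connectedness of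
    \<open>?U\<close> yields an arc from it to \<open>T 0\<close>.\<close>
  define W where "W = {w. reach (?U - T 0) (p 1) w}"
  have T1U: "T 1 \<subseteq> ?U - T 0" using TT[of 0 1] by auto
  have T1W: "T 1 \<subseteq> W"
    unfolding W_def using reach_mono[OF conn_reach[OF T1] T1U] by blast
  have W: "conn W" "W \<subseteq> Q \<union> T 1" "W \<inter> T 0 = {}"
    by (auto simp: W_def conn_component dest: reach_in(2))
  have T0W: "\<exists>u\<in>T 0. \<exists>v\<in>W. (u, v) \<in> A"
  proof -
    have "reach ?U (p 1) (p 0)" "p 1 \<in> W" "p 0 \<notin> W"
      using conn_reach[OF U] T0 T1 T1W W(3) by auto
    then obtain u v where uv: "reach (?U \<inter> W) (p 1) u" "(u, v) \<in> A" "v \<in> ?U" "v \<notin> W"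
      by (rule reach_exit)
    have uW: "u \<in> W" using reach_in(2)[OF uv(1)] by blast
    have "v \<in> T 0"
    proof (rule ccontr)
      assume "v \<notin> T 0"
      moreover have u: "reach (?U - T 0) (p 1) u" using uW by (simp add: W_def)
      ultimately have "reach (?U - T 0) u v" using uv(2,3) reach_in(2) by (intro reach_edge) blast+
      from reach_trans[OF u this] uv(4) show False by (simp add: W_def)
    qed
    then show ?thesis using uW symD[OF symA uv(2)] by blast
  qed
  define Z where "Z i = (if i < n then B i \<union> T (i + 2) else if i = n then T 0 else W)" for i
  have "conn (Z i) \<and> Z i \<noteq> {} \<and> Z i \<subseteq> S" if "i < n + 2" for i
  proof -
    have "conn (B i \<union> T (i + 2))" if i: "i < n"
    proof -
      obtain u v where "u \<in> T (i + 2)" "v \<in> B i" "(u, v) \<in> A" using BT[of "i + 2" i] i by auto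
      moreover have "conn (T (i + 2))" "conn (B i)" using T[of "i + 2"] B i by auto
      ultimately have "conn (T (i + 2) \<union> B i)" using conn_Un by blast
      then show ?thesis by (simp add: Un_commute)
    qed
    moreover have "Q \<subseteq> S" using Q(4) KS by blast
    ultimately show ?thesis
      using that B[of i] T[of "i + 2"] TS[of "i + 2"] T0 TS[of 0] TS[of 1] W(1,2) T1(2) T1W
      unfolding Z_def by auto
  qed
  moreover have main: "Z i \<inter> Z j = {} \<and> (\<exists>u\<in>Z i. \<exists>v\<in>Z j. (u, v) \<in> A)" if less: "i < j" "j < n + 2" for i j
  proof -
    have "j < n \<or> i < n \<and> j = n \<or> i < n \<and> j = n + 1 \<or> i = n \<and> j = n + 1"
      using less by arith
    then consider "j < n" | "i < n" "j = n" | "i < n" "j = n + 1" | "i = n" "j = n + 1"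
      by blast
    then show ?thesis
    proof cases
      case 1
      then have ij: "i < n" "i + 2 < n + 2" "j + 2 < n + 2" using less by auto
      \<comment> \<open>Every leg reaches every ball, so the leg inside \<open>Z j\<close> already
        provides the arc to \<open>Z i\<close>.\<close>
      obtain u v where "u \<in> T (j + 2)" "v \<in> B i" "(v, u) \<in> A" using BT[OF ij(3,1)] symD[OF symA] by blast
      moreover have "(B i \<union> T (i + 2)) \<inter> (B j \<union> T (j + 2)) = {}"
        using BB[OF ij(1) 1] BT[OF ij(2) 1] BT[OF ij(3,1)] TT[OF ij(2,3)] less(1) by auto
      ultimately show ?thesis using 1 ij by (auto simp: Z_def)
    next
      case 2
      then have i: "i + 2 < n + 2" by simp
      obtain u v where "u \<in> T 0" "v \<in> B i" "(v, u) \<in> A" using BT[of 0 i] 2 symD[OF symA] by auto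
      moreover have "(B i \<union> T (i + 2)) \<inter> T 0 = {}" using BT[of 0 i] TT[OF i, of 0] 2 by auto
      ultimately show ?thesis using 2 by (auto simp: Z_def)
    next
      case 3
      then have i: "i + 2 < n + 2" by simp
      obtain u v where "u \<in> T 1" "v \<in> B i" "(v, u) \<in> A" using BT[of 1 i] 3 symD[OF symA] by auto
      moreover have "(B i \<union> T (i + 2)) \<inter> (Q \<union> T 1) = {}"
        using BT[of 1 i] TT[OF i, of 1] QT[OF _ i] B[OF 3(1)] Q(4) 3 by auto
      then have "(B i \<union> T (i + 2)) \<inter> W = {}" using W(2) by blast
      ultimately show ?thesis using 3 T1W by (auto simp: Z_def)
    next
      case 4
      then show ?thesis using T0W W(3) by (auto simp: Z_def)
    qed
  qed
  moreover have "Z i \<inter> Z j = {} \<and> (\<exists>u\<in>Z i. \<exists>v\<in>Z j. (u, v) \<in> A)"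
    if "i < n + 2" "j < n + 2" "i \<noteq> j" for i j
  proof (cases "i < j")
    case True
    then show ?thesis using main that by blast
  next
    case False
    then have "j < i" using that by simp
    from main[OF this that(1)] show ?thesis using symD[OF symA] by blast
  qed
  ultimately show ?thesis by (intro exI[of _ Z]) blast
qed

end

section \<open>Region intersection graphs\<close>

lemma rtrancl_on_restrict:
  "rtrancl_on S (R \<inter> S \<times> S) = rtrancl_on S R"
proof
  show "rtrancl_on S (R \<inter> S \<times> S) \<subseteq> rtrancl_on S R"
    using rtrancl_on_mono[of "R \<inter> S \<times> S" R S S] by auto
  show "rtrancl_on S R \<subseteq> rtrancl_on S (R \<inter> S \<times> S)"
  proof clarify
    fix x y assume "(x, y) \<in> rtrancl_on S R"
    then show "(x, y) \<in> rtrancl_on S (R \<inter> S \<times> S)"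
      by (induction rule: rtrancl_on_induct) (auto intro: rtrancl_on_into_rtrancl_on)
  qed
qed

lemma connected_vertex_set_iff:
  assumes "sym (parcs H)"
  shows "connected_vertex_set H S \<longleftrightarrow>
    S \<subseteq> pverts H \<and> S \<noteq> {} \<and> (\<forall>x\<in>S. \<forall>y\<in>S. (x, y) \<in> rtrancl_on S (parcs H))"
proof -
  have "parcs (mk_symmetric (with_proj H \<restriction> S)) = parcs H \<inter> S \<times> S"
    using assms by (auto simp: mk_symmetric_def sym_def)
  moreover have "pverts (mk_symmetric (with_proj H \<restriction> S)) = S"
    by (simp add: mk_symmetric_def)
  ultimately show ?thesis
    by (simp add: connected_vertex_set_def connected_def strongly_connected_def reachable_def
        rtrancl_on_restrict)
qed

lemma pair_graph_sym: "pair_graph G \<Longrightarrow> sym (parcs G)"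
proof -
  assume "pair_graph G"
  then interpret pair_graph G .
  show ?thesis using pair_sym_arcs by (simp add: symmetric_def)
qed

text \<open>Adding the identity makes the power mean distance at most \<open>n\<close>.\<close>

abbreviation hops :: "'a pair_pre_digraph \<Rightarrow> nat \<Rightarrow> 'a rel" where
  "hops G n \<equiv> (parcs G \<union> Id) ^^ n"

lemma hops_trans: "(x, y) \<in> hops G m \<Longrightarrow> (y, z) \<in> hops G n \<Longrightarrow> (x, z) \<in> hops G (m + n)"
  by (auto simp: relpow_add)

lemma hops_refl: "(x, x) \<in> hops G n"
  by (induction n) auto

lemma hops_mono: "(x, y) \<in> hops G m \<Longrightarrow> m \<le> n \<Longrightarrow> (x, y) \<in> hops G n"
  using hops_trans[OF _ hops_refl[where x = y and n = "n - m"], of x m G] by simp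

lemma hops_sym: "sym (parcs G) \<Longrightarrow> (x, y) \<in> hops G n \<Longrightarrow> (y, x) \<in> hops G n"
proof (induction n arbitrary: y)
  case (Suc n)
  from Suc.prems(2) obtain z where z: "(x, z) \<in> hops G n" "(z, y) \<in> parcs G \<union> Id" by auto
  have "(y, z) \<in> parcs G \<union> Id" using z(2) Suc.prems(1) by (auto dest: symD)
  from relpow_Suc_I2[OF this Suc.IH[OF Suc.prems(1) z(1)]] show ?case .
qed auto

lemma hops_in_verts:
  assumes "pair_graph G" "(x, y) \<in> hops G n" "x \<in> pverts G"
  shows "y \<in> pverts G"
proof -
  interpret pair_graph G by fact
  show ?thesis using assms(2,3)
    by (induction n arbitrary: y) (auto dest: in_arcsD2)
qed

text \<open>An infimum of a nonempty set of extended naturals is attained, which gives a path of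
  length at most \<open>n\<close>. Conversely, a walk is shortened to a path by removing
  cycles.\<close>

lemma graph_dist_le_iff:
  assumes G: "pair_graph G" and x: "x \<in> pverts G"
  shows "graph_dist G x y \<le> enat n \<longleftrightarrow> (x, y) \<in> hops G n"
proof
  interpret pair_graph G by fact
  have walk: "awalk x p y \<Longrightarrow> (x, y) \<in> hops G (length p)" for x p y
  proof (induction p arbitrary: x)
    case Nil
    then show ?case by (auto simp: awalk_def)
  next
    case (Cons e p)
    then have "(x, snd e) \<in> parcs G \<union> Id" "(snd e, y) \<in> hops G (length p)"
      by (auto simp: awalk_Cons_iff)
    from relpow_Suc_I2[OF this] show ?case by simp
  qed
  assume le: "graph_dist G x y \<le> enat n"
  let ?L = "(\<lambda>p. enat (length p)) ` {p. apath x p y}"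
  have dist: "graph_dist G x y = Inf ?L" by (simp add: graph_dist_def)
  have "?L \<noteq> {}"
  proof
    assume "?L = {}"
    then have "graph_dist G x y = \<infinity>" unfolding dist by (simp add: top_enat_def)
    with le show False by simp
  qed
  then have "Inf ?L \<in> ?L" using wellorder_InfI[of _ ?L] by blast
  then obtain p where "apath x p y" "length p \<le> n" using le dist by auto
  then have "(x, y) \<in> hops G (length p)" using walk by (simp add: apath_def)
  then show "(x, y) \<in> hops G n" using \<open>length p \<le> n\<close> by (rule hops_mono)
next
  interpret pair_graph G by fact
  assume "(x, y) \<in> hops G n"
  then have "\<exists>p. awalk x p y \<and> length p \<le> n"
  proof (induction n arbitrary: y)
    case 0
    then show ?case using x by (intro exI[of _ "[]"]) (auto simp: awalk_def)
  next
    case (Suc n)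
    then obtain z where z: "(x, z) \<in> hops G n" "(z, y) \<in> parcs G \<union> Id" by auto
    from Suc.IH[OF z(1)] obtain p where p: "awalk x p z" "length p \<le> n" by blast
    show ?case
    proof (cases "z = y")
      case True
      then show ?thesis using p by auto
    next
      case False
      then have "awalk z [(z, y)] y" using z(2) arc_implies_awalk[of "(z, y)"] by auto
      with p show ?thesis by (intro exI[of _ "p @ [(z, y)]"]) auto
    qed
  qed
  then obtain p where p: "awalk x p y" "length p \<le> n" by blast
  from p(1) have "\<exists>q. apath x q y \<and> length q \<le> length p"
  proof (induction rule: awalk_to_apath_induct)
    case (path p)
    then show ?case by (auto simp: apath_def)
  next
    case (decomp p q r s)
    from decomp(2,1,3) have "p = q @ r @ s" by (rule awalk_cyc_decompE)
    with decomp(4) show ?case by auto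
  qed
  then obtain q where "apath x q y" "length q \<le> n" using p(2) by auto
  then have "graph_dist G x y \<le> enat (length q)"
    unfolding graph_dist_def by (intro INF_lower) auto
  with \<open>length q \<le> n\<close> show "graph_dist G x y \<le> enat n" by (meson enat_ord_simps(1) order_trans)
qed

section \<open>The partition of the region intersection graph\<close>

text \<open>Each vertex \<open>v\<close> is represented by a point \<open>h v\<close> of its model
  set, and the monochromatic components in H are pulled back along \<open>h\<close>. A chain bounds
  the number of region steps by \<open>(n + 1) * (24 * n + 1)\<close>; a step costs
  \<open>2 * \<delta> + 1\<close> hops in G, and one further hop starts the count.\<close>

lemma region_intersection_partition:
  fixes G :: "'b pair_pre_digraph" and H :: "'a pair_pre_digraph"
  assumes G: "pair_graph G" and H: "pair_graph H" and model: "region_intersection_model G H m"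
    and no_minor: "\<not> is_minor (complete_graph (n + 2)) H"
  shows "\<exists>U. partition_on (pverts G) U \<and> k_disjoint_family_at G (2 ^ n) \<delta> U \<and>
    (\<forall>S\<in>U. diam_in G S \<le> enat ((n + 1) * (24 * n + 1) * (2 * \<delta> + 1) + 1))"
proof -
  note symG = pair_graph_sym[OF G] and symH = pair_graph_sym[OF H]
  interpret H: pair_graph H by fact
  have m: "m v \<subseteq> pverts H" "m v \<noteq> {}" "\<And>x y. x \<in> m v \<Longrightarrow> y \<in> m v \<Longrightarrow> (x, y) \<in> rtrancl_on (m v) (parcs H)"
    if "v \<in> pverts G" for v
    using model that unfolding region_intersection_model_def connected_vertex_set_iff[OF symH] by blast+
  have meet: "m u \<inter> m v \<noteq> {} \<longleftrightarrow> (u, v) \<in> parcs G \<union> Id" if "u \<in> pverts G" "v \<in> pverts G" for u v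
    using model that m(2)[OF that(1)] unfolding region_intersection_model_def by (cases "u = v") auto
  define reg where "reg k v = (\<Union>u\<in>{u. (v, u) \<in> hops G k}. m u)" for k v
  define h where "h v = (SOME x. x \<in> m v)" for v
  have h: "h v \<in> m v" if "v \<in> pverts G" for v
    unfolding h_def using m(2)[OF that] by (simp add: some_in_eq)
  have reg_mono: "reg k v \<subseteq> reg (Suc k) v" for k v
    unfolding reg_def by auto
  have m_reg: "m v \<subseteq> reg k v" for v k
    using hops_refl[where x = v and G = G and n = k] unfolding reg_def by blast
  \<comment> \<open>Model sets of adjacent vertices meet, so the union over a ball is connected;
    this goes by induction on the radius.\<close>
  have reg_conn: "(h v, x) \<in> rtrancl_on (reg k v) (parcs H)"
    if "v \<in> pverts G" "(v, u) \<in> hops G k" "x \<in> m u" for v u k x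
    using that(2,3)
  proof (induction k arbitrary: u x)
    case 0
    then have "(h v, x) \<in> rtrancl_on (m v) (parcs H)" using m(3)[OF that(1) h[OF that(1)]] by simp
    then show ?case by (rule rtrancl_on_mono[OF order_refl m_reg])
  next
    case (Suc k)
    then obtain w where w: "(v, w) \<in> hops G k" "(w, u) \<in> parcs G \<union> Id" by auto
    have verts: "w \<in> pverts G" "u \<in> pverts G"
      using hops_in_verts[OF G _ that(1)] w(1) Suc.prems(1) by blast+
    then obtain y where y: "y \<in> m w" "y \<in> m u" using meet w(2) by blast
    have "(h v, y) \<in> rtrancl_on (reg (Suc k) v) (parcs H)"
      using rtrancl_on_mono[OF order_refl reg_mono Suc.IH[OF w(1) y(1)]] .
    moreover have "m u \<subseteq> reg (Suc k) v" using Suc.prems(1) unfolding reg_def by blast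
    then have "(y, x) \<in> rtrancl_on (reg (Suc k) v) (parcs H)"
      by (rule rtrancl_on_mono[OF order_refl _ m(3)[OF verts(2) y(2) Suc.prems(2)]])
    ultimately show ?case by (rule rtrancl_on_trans)
  qed
  define Rg where "Rg = reg \<delta> ` pverts G"
  \<comment> \<open>Arcs of H contained in no region are dropped, as \<open>cover\<close> demands.
    No region loses connectivity by this.\<close>
  define A where "A = {(x, y) \<in> parcs H. \<exists>\<rho>\<in>Rg. x \<in> \<rho> \<and> y \<in> \<rho>}"
  interpret region_cover A Rg
    by unfold_locales (use symH in \<open>auto simp: A_def sym_def\<close>)
  have reach_reg: "reach (reg \<delta> v) (h v) x" if "v \<in> pverts G" "x \<in> reg \<delta> v" for v x
  proof -
    have "(h v, x) \<in> rtrancl_on (reg \<delta> v) (parcs H)"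
      using that reg_conn unfolding reg_def by blast
    then have "(h v, x) \<in> rtrancl_on (reg \<delta> v) (parcs H \<inter> reg \<delta> v \<times> reg \<delta> v)"
      by (simp add: rtrancl_on_restrict)
    moreover have "parcs H \<inter> reg \<delta> v \<times> reg \<delta> v \<subseteq> A" using that(1) by (auto simp: A_def Rg_def)
    ultimately show ?thesis
      unfolding reach_def using rtrancl_on_mono[OF _ order_refl] by metis
  qed
  have reach_H: "(x, y) \<in> rtrancl_on S (parcs H)" if "reach S x y" for S x y
  proof -
    have "A \<subseteq> parcs H" by (auto simp: A_def)
    from rtrancl_on_mono[OF this order_refl] show ?thesis using that unfolding reach_def .
  qed
  define Cp where "Cp v = {z. reach UNIV (h v) z}" for v
  have Cp: "conn (Cp v)" "h v \<in> Cp v" for v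
    by (auto simp: Cp_def conn_component reach_refl)
  have Cp_H: "Cp v \<subseteq> pverts H" if "v \<in> pverts G" for v
  proof
    fix x assume "x \<in> Cp v"
    then have "(h v, x) \<in> rtrancl_on UNIV A" by (simp add: Cp_def reach_def)
    then show "x \<in> pverts H"
      by (cases rule: rtrancl_on.cases) (use h[OF that] m(1)[OF that] H.in_arcsD2 in \<open>auto simp: A_def\<close>)
  qed
  obtain c :: "'a set \<Rightarrow> 'a \<Rightarrow> nat" where c: "\<And>S x. c S x < 2 ^ n"
    and c_chain: "\<And>S x y. conn S \<Longrightarrow> x \<in> S \<Longrightarrow>
      (\<lambda>u v. (u, v) \<in> step S \<and> c S u = c S v)\<^sup>*\<^sup>* x y \<Longrightarrow> \<exists>K. chain n S K \<and> x \<in> K \<and> y \<in> K"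
    using chain_coloring[of n] by blast
  define mono where "mono S = (\<lambda>x y. (x, y) \<in> step S \<and> c S x = c S y)\<^sup>*\<^sup>*" for S
  have mono_sym: "mono S y x" if "mono S x y" for S x y
    using that unfolding mono_def
    by (induction rule: rtranclp_induct) (auto intro: converse_rtranclp_into_rtranclp step_sym)
  have mono_color: "c S x = c S y" if "mono S x y" for S x y
    using that unfolding mono_def by (induction rule: rtranclp_induct) auto
  \<comment> \<open>A step joins two points of one region \<open>reg \<delta> v\<close>: going
    through \<open>v\<close> costs \<open>2 * \<delta>\<close> hops, and one more passes to
    \<open>w\<close>, whose model set shares \<open>y\<close>. For \<open>k = 0\<close> the single
    hop is needed because \<open>h u\<close> may also lie in \<open>m w\<close>.\<close>
  have near_hops: "(u, w) \<in> hops G (k * (2 * \<delta> + 1) + 1)"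
    if "near S k (h u) y" "y \<in> m w" "u \<in> pverts G" "w \<in> pverts G" for S k u y w
    using that(1,2,4)
  proof (induction k arbitrary: y w)
    case 0
    then have "m u \<inter> m w \<noteq> {}" using h[OF that(3)] by (auto simp: near_0)
    then show ?case using meet[OF that(3) 0(3)] by simp
  next
    case (Suc k)
    from Suc.prems(1) obtain z where z: "near S k (h u) z" "(z, y) \<in> step S" by (auto simp: near_def)
    show ?case
    proof (cases "z = y")
      case True
      then have "(u, w) \<in> hops G (k * (2 * \<delta> + 1) + 1)" using Suc.IH[OF _ Suc.prems(2,3)] z(1) by blast
      then show ?thesis by (rule hops_mono) simp
    next
      case False
      then obtain \<rho> where "\<rho> \<in> Rg" "reach (S \<inter> \<rho>) z y" using z(2) by (auto simp: step_def)
      then obtain v where v: "v \<in> pverts G" "z \<in> reg \<delta> v" "y \<in> reg \<delta> v"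
        using reach_in by (fastforce simp: Rg_def)
      then obtain w1 w2 where w: "(v, w1) \<in> hops G \<delta>" "z \<in> m w1" "(v, w2) \<in> hops G \<delta>" "y \<in> m w2"
        by (auto simp: reg_def)
      have verts: "w1 \<in> pverts G" "w2 \<in> pverts G" using hops_in_verts[OF G _ v(1)] w by blast+
      have "(w2, w) \<in> hops G 1" using meet[OF verts(2) Suc.prems(3)] w(4) Suc.prems(2) by auto
      from hops_trans[OF hops_trans[OF hops_trans[OF Suc.IH[OF z(1) w(2) verts(1)]
            hops_sym[OF symG w(1)]] w(3)] this]
      show ?thesis by (rule hops_mono) simp
    qed
  qed
  define r where "r = {(u, v). u \<in> pverts G \<and> v \<in> pverts G \<and> Cp u = Cp v \<and> mono (Cp u) (h u) (h v)}"
  have r: "equiv (pverts G) r"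
  proof (rule equivI)
    show "r \<subseteq> pverts G \<times> pverts G" by (auto simp: r_def)
    show "refl_on (pverts G) r" by (auto simp: refl_on_def r_def mono_def)
    show "sym r" using mono_sym by (auto simp: sym_def r_def)
    show "trans r" by (auto simp: trans_def r_def mono_def)
  qed
  define U where "U = pverts G // r"
  have "partition_on (pverts G) U" unfolding U_def by (rule partition_on_quotient[OF r])
  moreover have "diam_in G X \<le> enat ((n + 1) * (24 * n + 1) * (2 * \<delta> + 1) + 1)" if "X \<in> U" for X
    unfolding diam_in_def
  proof (intro SUP_least)
    fix u v assume "u \<in> X" "v \<in> X"
    then have "(u, v) \<in> r" using that quotient_eq_iff[OF r, of X X u v] unfolding U_def by blast
    then have uv: "u \<in> pverts G" "v \<in> pverts G" "mono (Cp u) (h u) (h v)" by (auto simp: r_def)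
    obtain K where K: "chain n (Cp u) K" "h u \<in> K" "h v \<in> K"
      using c_chain[OF Cp] uv(3) unfolding mono_def by blast
    have "near (Cp u) ((n + 1) * (24 * n + 1)) (h u) (h v)"
    proof (rule ccontr)
      assume "\<not> ?thesis"
      from chain_far_clique_minor[OF K this] obtain Z :: "nat \<Rightarrow> 'a set" where
        Z: "\<And>i. i < n + 2 \<Longrightarrow> conn (Z i) \<and> Z i \<noteq> {} \<and> Z i \<subseteq> Cp u"
        and ZZ: "\<And>i j. i < n + 2 \<Longrightarrow> j < n + 2 \<Longrightarrow> i \<noteq> j \<Longrightarrow>
          Z i \<inter> Z j = {} \<and> (\<exists>u\<in>Z i. \<exists>v\<in>Z j. (u, v) \<in> A)"
        by blast
      have "connected_vertex_set H (Z i)" if "i < n + 2" for i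
        unfolding connected_vertex_set_iff[OF symH]
        using Z[OF that] Cp_H[OF uv(1)] reach_H conn_reach by blast
      moreover have "\<exists>x\<in>Z i. \<exists>y\<in>Z j. (x, y) \<in> parcs H" if "i < n + 2" "j < n + 2" "i \<noteq> j" for i j
        using ZZ[OF that] by (auto simp: A_def)
      ultimately have "is_minor (complete_graph (n + 2)) H"
        unfolding is_minor_def complete_graph_def using ZZ by (intro exI[of _ Z]) auto
      with no_minor show False by blast
    qed
    from near_hops[OF this h[OF uv(2)] uv(1,2)]
    show "graph_dist G u v \<le> enat ((n + 1) * (24 * n + 1) * (2 * \<delta> + 1) + 1)"
      using graph_dist_le_iff[OF G uv(1)] by blast
  qed
  moreover have "k_disjoint_family_at G (2 ^ n) \<delta> U"
  proof -
    \<comment> \<open>Colours start at \<open>0\<close> while the families are indexed from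
      \<open>1\<close>.\<close>
    define W where "W i = {X \<in> U. \<exists>v\<in>X. c (Cp v) (h v) = i - 1}" for i :: nat
    have "U \<subseteq> (\<Union>i\<in>{1..2 ^ n}. W i)"
    proof
      fix X assume "X \<in> U"
      then obtain v where "v \<in> X" unfolding U_def by (metis equals0I in_quotient_imp_non_empty r)
      then have "X \<in> W (c (Cp v) (h v) + 1)" "c (Cp v) (h v) + 1 \<in> {1..2 ^ n}"
        using \<open>X \<in> U\<close> c[of "Cp v" "h v"] by (auto simp: W_def)
      then show "X \<in> (\<Union>i\<in>{1..2 ^ n}. W i)" by blast
    qed
    then have "U = (\<Union>i\<in>{1..2 ^ n}. W i)" by (auto simp: W_def)
    moreover have "disjoint_family_at G \<delta> (W i)" for i
      unfolding disjoint_family_at_def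
    proof (intro ballI impI)
      fix X Y assume XY: "X \<in> W i" "Y \<in> W i" "X \<noteq> Y"
      have U: "X \<in> U" "Y \<in> U" using XY by (auto simp: W_def)
      have color: "c (Cp u) (h u) = i - 1" if "Z \<in> W i" "u \<in> Z" for u Z
      proof -
        obtain v where v: "v \<in> Z" "c (Cp v) (h v) = i - 1" and "Z \<in> U" using \<open>Z \<in> W i\<close> by (auto simp: W_def)
        then have "(u, v) \<in> r" using quotient_eq_iff[OF r, of Z Z u v] that(2) unfolding U_def by blast
        then show ?thesis using v(2) mono_color by (auto simp: r_def)
      qed
      \<comment> \<open>If \<open>y\<close> is within \<delta> of \<open>x\<close>, then
        \<open>h y\<close> lies in the region of \<open>x\<close>, so \<open>h x\<close> and
        \<open>h y\<close> are one step apart; with equal colours this puts \<open>x\<close> and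
        \<open>y\<close> in one class. The bound with \<open>Suc \<delta>\<close> passes to the
        infimum, which a strict inequality need not do.\<close>
      have "enat (Suc \<delta>) \<le> graph_dist G x y" if xy: "x \<in> X" "y \<in> Y" for x y
      proof (rule ccontr)
        have verts: "x \<in> pverts G" "y \<in> pverts G"
          using xy U Union_quotient[OF r] unfolding U_def by blast+
        assume "\<not> ?thesis"
        then have "graph_dist G x y \<le> enat \<delta>" by (cases "graph_dist G x y") auto
        then have "(x, y) \<in> hops G \<delta>" using graph_dist_le_iff[OF G verts(1)] by blast
        then have "h y \<in> reg \<delta> x" using h[OF verts(2)] by (auto simp: reg_def)
        from reach_reg[OF verts(1) this] have hxy: "reach (reg \<delta> x) (h x) (h y)" .
        have sub: "{z. reach (reg \<delta> x) (h x) z} \<subseteq> Cp x \<inter> reg \<delta> x"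
          by (auto simp: Cp_def intro: reach_mono dest: reach_in(2))
        from reach_mono[OF reach_component[OF hxy] sub] have "reach (Cp x \<inter> reg \<delta> x) (h x) (h y)" .
        moreover from this have "h x \<in> Cp x" "h y \<in> Cp x" using reach_in by blast+
        moreover have "reg \<delta> x \<in> Rg" using verts(1) by (simp add: Rg_def)
        ultimately have st: "(h x, h y) \<in> step (Cp x)" unfolding step_def by blast
        have "reach UNIV (h x) (h y)" using hxy by (rule reach_mono) simp
        then have "Cp x = Cp y"
          unfolding Cp_def using reach_trans reach_sym by blast
        moreover have "c (Cp x) (h x) = c (Cp x) (h y)"
          using color[OF XY(1) xy(1)] color[OF XY(2) xy(2)] \<open>Cp x = Cp y\<close> by simp
        ultimately have "(x, y) \<in> r" using verts st by (auto simp: r_def mono_def)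
        then have "X = Y" using quotient_eq_iff[OF r, of X Y x y] U xy unfolding U_def by blast
        with XY(3) show False by blast
      qed
      then have "enat (Suc \<delta>) \<le> (INF x\<in>X. INF y\<in>Y. graph_dist G x y)"
        by (intro INF_greatest)
      then show "enat \<delta> < (INF x\<in>X. INF y\<in>Y. graph_dist G x y)"
        by (rule less_le_trans[rotated]) simp
    qed
    ultimately show ?thesis unfolding k_disjoint_family_at_def by (intro exI[of _ W]) blast
  qed
  ultimately show ?thesis by blast
qed

theorem theorem1p3:
  fixes t :: nat
    and \<H> :: "'a pair_pre_digraph set"
  assumes "t \<ge> 2"
    and "\<And>H. H \<in> \<H> \<Longrightarrow> pair_graph H"
    and "\<And>H. H \<in> \<H> \<Longrightarrow> \<not> is_minor (complete_graph t) H"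
  shows "asymptotic_dimension (region_intersection_graphs \<H> :: 'b pair_pre_digraph set)
           \<le> enat (2 ^ (t - 2) - 1)"
proof -
  define n where "n = t - 2"
  have t: "t = n + 2" using assms(1) by (simp add: n_def)
  let ?f = "\<lambda>\<delta>. (n + 1) * (24 * n + 1) * (2 * \<delta> + 1) + 1"
  \<comment> \<open>Dimension \<open>d\<close> allows \<open>d + 1\<close> families, here
    \<open>2 ^ n\<close>.\<close>
  have "control_function (2 ^ n - 1) ?f G"
    if "G \<in> region_intersection_graphs \<H>" for G :: "'b pair_pre_digraph"
  proof -
    from that obtain H m where "pair_graph G" "H \<in> \<H>" "region_intersection_model G H m"
      by (auto simp: region_intersection_graphs_def)
    from region_intersection_partition[OF this(1) assms(2)[OF this(2)] this(3) assms(3)[OF this(2), unfolded t]]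
    show ?thesis by (simp add: control_function_def)
  qed
  then show ?thesis
    unfolding asymptotic_dimension_def n_def[symmetric] by (intro INF_lower) blast
qed

end
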